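(* Let $s\in(0,1)$. Let $D$ be an open set of $\mathbb R^n$, contained in the halfspace $\{x_n>0\}$. Let $v:\mathbb R^n\to\mathbb R$ be such that $v\in L^\infty(D)\cap C^2(D)$, $v$ is continuous on $\overline D$, and $$\begin{cases}(-\Delta)^sv\le0&\text{in }D,\\ v\le0&\text{in }D^c.\end{cases}$$ Then $v\le0$ in $D$.
   Context: $D^c=\mathbb R^n\setminus D$. $(-\Delta)^sv(x)$ is, up to a positive constant, $\frac12\int_{\mathbb R^n}\frac{2v(x)-v(x+y)-v(x-y)}{|y|^{n+2s}}\,dy$. *)

theory Defs
  imports "HOL-Analysis.Analysis"
begin

definition C2_on :: "'a::real_normed_vector set \<Rightarrow> ('a \<Rightarrow> real) \<Rightarrow> bool" where
  "C2_on D v \<longleftrightarrow>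
     (\<exists>(v' :: 'a \<Rightarrow> 'a \<Rightarrow>\<^sub>L real) (v'' :: 'a \<Rightarrow> 'a \<Rightarrow>\<^sub>L 'a \<Rightarrow>\<^sub>L real).
        (\<forall>x\<in>D. (v has_derivative blinfun_apply (v' x)) (at x)) \<and>
        (\<forall>x\<in>D. (v' has_derivative blinfun_apply (v'' x)) (at x)) \<and>
        continuous_on D v'')"

definition Linfty_on :: "'a::euclidean_space set \<Rightarrow> ('a \<Rightarrow> real) \<Rightarrow> bool" where
  "Linfty_on D v \<longleftrightarrow>
     v \<in> borel_measurable (lebesgue_on D) \<and> (\<exists>C. AE x in lebesgue_on D. \<bar>v x\<bar> \<le> C)"

definition frac_lap_integrand :: "real \<Rightarrow> (real^'n \<Rightarrow> real) \<Rightarrow> real^'n \<Rightarrow> real^'n \<Rightarrow> real" where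
  "frac_lap_integrand s v x y =
     (2 * v x - v (x + y) - v (x - y)) / norm y powr (real CARD('n) + 2 * s)"

(* The Bochner integral of a non-integrable function is 0 by convention, so every
   condition on the value of frac_lap must be accompanied by this predicate.
   If v is bounded above and C^2 near x, the negative part of the integrand is
   integrable, so the integral of a measurable integrand can only diverge to
   +infinity; the predicate together with frac_lap c s v x \<le> 0 is then the same as
   nonpositivity of the extended-real-valued integral. *)
definition frac_lap_exists :: "real \<Rightarrow> (real^'n \<Rightarrow> real) \<Rightarrow> real^'n \<Rightarrow> bool" where
  "frac_lap_exists s v x \<longleftrightarrow> integrable lebesgue (frac_lap_integrand s v x)"

(* (-Delta)^s v(x); the factor c is the positive normalising constant, which depends
   on n and s only and is left unspecified. *)
definition frac_lap :: "real \<Rightarrow> real \<Rightarrow> (real^'n \<Rightarrow> real) \<Rightarrow> real^'n \<Rightarrow> real" where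
  "frac_lap c s v x = c * (1/2 * (LINT y|lebesgue. frac_lap_integrand s v x y))"

end

theory Submission
  imports Defs
begin

text \<open>Suppose \<open>M = sup\<^sub>D v > 0\<close>. Take a point \<open>x0\<close> of \<open>D\<close> with \<open>v x0 > M - d\<close>, let \<open>R\<close> be its
height, and add to \<open>v\<close> the cap \<open>d max(0, 1 - |x - x0|\<^sup>2 / R\<^sup>2)\<close>. The sum attains its maximum,
at a point \<open>x1\<close> of \<open>D\<close> of height at most \<open>2R\<close>. There the half-space \<open>{x\<^sub>k \<le> 0}\<close> contributes at least
\<open>a M R\<^sup>-\<^sup>2\<^sup>s\<close> to the fractional Laplacian of the sum, whereas the cap contributes at most
\<open>d C R\<^sup>-\<^sup>2\<^sup>s\<close>, with \<open>a\<close> and \<open>C\<close> independent of \<open>d\<close> and \<open>R\<close>. For small \<open>d\<close> this is incompatible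
with \<open>(-\<Delta>)\<^sup>s v \<le> 0\<close> at \<open>x1\<close>.\<close>

section \<open>Dyadic shells and the integral of the truncated kernel\<close>

lemma dyadic_scale_ge:
  fixes t R :: real
  assumes "0 < R" "R \<le> t"
  obtains j :: nat where "2 ^ j * R / 2 \<le> t" "t < 2 ^ j * R"
proof -
  define j where "j = (LEAST j. t < 2 ^ j * R)"
  obtain i where "t / R < 2 ^ i"
    using real_arch_pow[of 2 "t / R"] by auto
  then have ex: "t < 2 ^ i * R"
    using assms by (simp add: field_simps)
  have 1: "t < 2 ^ j * R"
    unfolding j_def by (rule LeastI[of _ i]) (rule ex)
  then obtain m where m: "j = Suc m"
    using assms by (cases j) auto
  then have "\<not> t < 2 ^ m * R"
    unfolding j_def by (metis lessI not_less_Least)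
  with 1 m show thesis
    by (intro that[of j]) auto
qed

text \<open>Exchanging \<open>t\<close> and \<open>R\<close> in the previous lemma gives
  \<open>2 ^ m * t \<le> R < 2 ^ (m + 1) * t\<close>. The exchange also swaps strict and weak
  inequalities, so \<open>2 ^ m * t = R\<close> is a separate case, where the exponent drops by
  one.\<close>

lemma dyadic_scale_less:
  fixes t R :: real
  assumes "0 < t" "t < R"
  obtains j :: nat where "R / 2 ^ j / 2 \<le> t" "t < R / 2 ^ j"
proof -
  obtain j :: nat where j: "2 ^ j * t / 2 \<le> R" "R < 2 ^ j * t"
    using dyadic_scale_ge[of t R] assms by auto
  then obtain m where m: "j = Suc m"
    using assms by (cases j) auto
  show thesis
  proof (cases "2 ^ m * t = R")
    case True
    then obtain l where l: "m = Suc l"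
      using assms by (cases m) auto
    show thesis
      using True assms by (intro that[of l]) (auto simp: field_simps l)
  next
    case False
    with j m have "2 ^ m * t < R"
      by auto
    with j m show thesis
      by (intro that[of m]) (auto simp: field_simps)
  qed
qed

text \<open>\<open>S \<rho>\<close> majorises the kernel \<open>1 / norm y powr p\<close> on the
  shell between radii \<open>\<rho> / 2\<close> and \<open>\<rho>\<close>. It is spread over the
  whole ball, whose volume is explicit; this costs only a constant factor.\<close>

context
  fixes s :: real and p :: real
    and S :: "real \<Rightarrow> 'a::euclidean_space \<Rightarrow> real"
  assumes s: "0 < s" "s < 1"
  defines "p \<equiv> real DIM('a) + 2 * s"
  defines "S \<equiv> \<lambda>\<rho> y. (\<rho> / 2) powr (-p) * indicator (ball 0 \<rho>) y"
begin

private lemma nn_integral_shell: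
  assumes "0 < \<rho>"
  shows "(\<integral>\<^sup>+ y. ennreal (S \<rho> y) \<partial>lebesgue)
    = ennreal (2 powr p * unit_ball_vol (real DIM('a)) * \<rho> powr (- 2 * s))"
proof -
  have "(\<integral>\<^sup>+ y. ennreal (S \<rho> y) \<partial>lebesgue)
    = (\<integral>\<^sup>+ y. ennreal ((\<rho> / 2) powr (-p)) * indicator (ball (0::'a) \<rho>) y \<partial>lebesgue)"
    by (intro nn_integral_cong) (auto simp: S_def indicator_def)
  also have "\<dots> = ennreal ((\<rho> / 2) powr (-p)) * emeasure lebesgue (ball (0::'a) \<rho>)"
    by (subst nn_integral_cmult_indicator) auto
  also have "\<dots> = ennreal ((\<rho> / 2) powr (-p) * (unit_ball_vol (real DIM('a)) * \<rho> ^ DIM('a)))"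
    using assms by (simp add: emeasure_ball ennreal_mult)
  also have "(\<rho> / 2) powr (-p) * (unit_ball_vol (real DIM('a)) * \<rho> ^ DIM('a))
    = 2 powr p * unit_ball_vol (real DIM('a)) * (\<rho> powr (-p) * \<rho> powr (real DIM('a)))"
    using assms by (simp add: powr_divide powr_minus powr_realpow field_simps)
  also have "\<rho> powr (-p) * \<rho> powr (real DIM('a)) = \<rho> powr (- 2 * s)"
    by (simp add: p_def flip: powr_add)
  finally show ?thesis .
qed

private lemma kernel_le_shell:
  assumes "\<rho> / 2 \<le> norm y" "norm y < \<rho>" "m \<le> a" "0 \<le> a" "0 < \<rho>"
  shows "m / norm y powr p \<le> a * S \<rho> y"
proof -
  have "0 < norm y"
    using assms by linarith
  then have "m / norm y powr p \<le> a / norm y powr p"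
    using assms by (intro divide_right_mono) auto
  also have "\<dots> = a * norm y powr (-p)"
    by (simp add: powr_minus divide_simps)
  also have "\<dots> \<le> a * (\<rho> / 2) powr (-p)"
    using assms s by (intro mult_left_mono powr_mono2') (auto simp: p_def)
  also have "\<dots> = a * S \<rho> y"
    using assms by (simp add: S_def)
  finally show ?thesis .
qed

text \<open>Every nonzero \<open>y\<close> lies in a shell of outer radius \<open>2 ^ j * R\<close>
  or \<open>R / 2 ^ j\<close>, and the corresponding single term already dominates. On the inner
  shells \<open>(norm y / R)^2\<close> is at most \<open>(1/4) ^ j\<close>; this weight offsets the
  growth of the kernel near the origin.\<close>

private lemma kernel_le_shells:
  fixes y :: 'a
  assumes R: "0 < R"
  shows "ennreal (min 1 ((norm y / R)\<^sup>2) / norm y powr p)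
    \<le> (\<Sum>j. ennreal (S (2 ^ j * R) y)) + (\<Sum>j. ennreal ((1/4) ^ j * S (R / 2 ^ j) y))"
    (is "?g \<le> ?A + ?B")
proof -
  consider "y = 0" | "R \<le> norm y" | "0 < norm y" "norm y < R"
    by fastforce
  then show ?thesis
  proof cases
    case 1
    then show ?thesis by simp
  next
    case 2
    with R obtain j :: nat where j: "2 ^ j * R / 2 \<le> norm y" "norm y < 2 ^ j * R"
      by (rule dyadic_scale_ge)
    have "min 1 ((norm y / R)\<^sup>2) / norm y powr p \<le> 1 * S (2 ^ j * R) y"
      using j R by (intro kernel_le_shell) auto
    then have "?g \<le> ennreal (S (2 ^ j * R) y)"
      by (simp add: ennreal_leI)
    also have "\<dots> \<le> ?A"
      using sum_le_suminf[OF summableI, of "{j}" "\<lambda>j. ennreal (S (2 ^ j * R) y)"] by simp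
    finally show ?thesis
      by (simp add: add_increasing2)
  next
    case 3
    then obtain j :: nat where j: "R / 2 ^ j / 2 \<le> norm y" "norm y < R / 2 ^ j"
      by (rule dyadic_scale_less)
    have "(norm y / R)\<^sup>2 \<le> (1 / 2 ^ j)\<^sup>2"
      using j R by (intro power_mono) (auto simp: field_simps)
    also have "\<dots> = (1/4) ^ j"
      by (simp add: power2_eq_square power_one_over flip: power_mult_distrib)
    finally have "min 1 ((norm y / R)\<^sup>2) / norm y powr p \<le> (1/4) ^ j * S (R / 2 ^ j) y"
      using j R by (intro kernel_le_shell) auto
    then have "?g \<le> ennreal ((1/4) ^ j * S (R / 2 ^ j) y)"
      by (simp add: ennreal_leI)
    also have "\<dots> \<le> ?B"
      using sum_le_suminf[OF summableI, of "{j}" "\<lambda>j. ennreal ((1/4) ^ j * S (R / 2 ^ j) y)"]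
      by simp
    finally show ?thesis
      by (simp add: add_increasing)
  qed
qed

lemma truncated_kernel_integral_bound:
  obtains C where "0 \<le> C"
    "\<And>R. 0 < R \<Longrightarrow> integrable lebesgue (\<lambda>y::'a. min 1 ((norm y / R)\<^sup>2) / norm y powr p)"
    "\<And>R. 0 < R \<Longrightarrow> (LINT y::'a|lebesgue. min 1 ((norm y / R)\<^sup>2) / norm y powr p) \<le> C * R powr (- 2 * s)"
proof -
  define K where "K = 2 powr p * unit_ball_vol (real DIM('a))"
  \<comment> \<open>These are the ratios of the geometric series over the outer and the inner
    shells. \<open>q1 < 1\<close> amounts to \<open>0 < s\<close>, and \<open>q2 < 1\<close> to
    \<open>s < 1\<close>.\<close>
  define q1 q2 :: real where "q1 = 2 powr (- 2 * s)" and "q2 = 2 powr (2 * s) / 4"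
  have K: "0 \<le> K"
    by (simp add: K_def)
  have q1: "0 \<le> q1" "q1 < 1"
    using s by (auto simp: q1_def powr_less_one)
  have "2 powr (2 * s) < (2::real) powr 2"
    using s by (intro powr_less_mono) auto
  then have q2: "0 \<le> q2" "q2 < 1"
    by (auto simp: q2_def)
  define C where "C = K * (1 / (1 - q1)) + K * (1 / (1 - q2))"
  have C: "0 \<le> C"
    using K q1 q2 by (simp add: C_def)
  have meas: "(\<lambda>y::'a. min 1 ((norm y / R)\<^sup>2) / norm y powr p) \<in> borel_measurable lebesgue"
    for R :: real
    by (intro measurable_completion) measurable
  have Smeas: "(\<lambda>y. a * S \<rho> y) \<in> borel_measurable lebesgue" for a \<rho> :: real
    unfolding S_def by (intro borel_measurable_times borel_measurable_indicator) auto
  \<comment> \<open>The estimate is made for the extended nonnegative integral, so that its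
    finiteness yields integrability and the same constant then bounds the Bochner integral.\<close>
  have bound: "(\<integral>\<^sup>+ y. ennreal (min 1 ((norm (y::'a) / R)\<^sup>2) / norm y powr p) \<partial>lebesgue)
      \<le> ennreal (C * R powr (- 2 * s))" if R: "0 < R" for R
  proof -
    let ?r = "R powr (- 2 * s)"
    have powj: "(2 ^ j) powr t = ((2::real) powr t) ^ j" for j :: nat and t
    proof (induction j)
      case (Suc j)
      have "(2 ^ Suc j) powr t = 2 powr t * (2 ^ j) powr t"
        unfolding power_Suc by (rule powr_mult)
      with Suc show ?case
        by (simp only: power_Suc)
    qed (simp only: power_0 powr_one_eq_one)
    have A: "(\<integral>\<^sup>+ y. ennreal (S (2 ^ j * R) y) \<partial>lebesgue) = ennreal (K * ?r * q1 ^ j)" for j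
      using R powj[of j "- 2 * s"]
      by (subst nn_integral_shell) (simp_all only: K_def q1_def powr_mult mult_ac, simp)
    have B: "(\<integral>\<^sup>+ y. ennreal ((1/4) ^ j * S (R / 2 ^ j) y) \<partial>lebesgue)
        = ennreal (K * ?r * q2 ^ j)" for j
    proof -
      have "(\<integral>\<^sup>+ y. ennreal ((1/4) ^ j * S (R / 2 ^ j) y) \<partial>lebesgue)
        = (\<integral>\<^sup>+ y. ennreal ((1/4) ^ j) * ennreal (S (R / 2 ^ j) y) \<partial>lebesgue)"
        by (intro nn_integral_cong) (simp add: ennreal_mult' S_def)
      also have "\<dots> = ennreal ((1/4) ^ j) * (\<integral>\<^sup>+ y. ennreal (S (R / 2 ^ j) y) \<partial>lebesgue)"
        using Smeas[of 1] by (intro nn_integral_cmult) simp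
      also have "\<dots> = ennreal ((1/4) ^ j) * ennreal (K * (R / 2 ^ j) powr (- 2 * s))"
        using R by (subst nn_integral_shell) (auto simp: K_def)
      also have "\<dots> = ennreal ((1/4) ^ j * (K * (R / 2 ^ j) powr (- 2 * s)))"
        using K by (simp add: ennreal_mult')
      also have "(R / 2 ^ j) powr (- 2 * s) = ?r * (2 powr (2 * s)) ^ j"
        using R powj[of j "2 * s"] by (simp add: powr_divide powr_minus field_simps)
      finally show ?thesis
        by (simp add: q2_def power_divide mult_ac)
    qed
    have geo: "(\<Sum>j. ennreal (K * ?r * q ^ j)) = ennreal (K * ?r * (1 / (1 - q)))"
      if "0 \<le> q" "q < 1" for q
      using that K by (intro suminf_ennreal_eq sums_mult geometric_sums) auto
    have "(\<integral>\<^sup>+ y. ennreal (min 1 ((norm (y::'a) / R)\<^sup>2) / norm y powr p) \<partial>lebesgue)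
      \<le> (\<integral>\<^sup>+ y. (\<Sum>j. ennreal (S (2 ^ j * R) y))
            + (\<Sum>j. ennreal ((1/4) ^ j * S (R / 2 ^ j) y)) \<partial>lebesgue)"
      by (intro nn_integral_mono kernel_le_shells R)
    also have "\<dots> = (\<integral>\<^sup>+ y. (\<Sum>j. ennreal (S (2 ^ j * R) y)) \<partial>lebesgue)
        + (\<integral>\<^sup>+ y. (\<Sum>j. ennreal ((1/4) ^ j * S (R / 2 ^ j) y)) \<partial>lebesgue)"
      using Smeas[of 1] Smeas
      by (intro nn_integral_add borel_measurable_suminf_order measurable_compose[OF _ measurable_ennreal]) auto
    also have "\<dots> = (\<Sum>j. ennreal (K * ?r * q1 ^ j)) + (\<Sum>j. ennreal (K * ?r * q2 ^ j))"
      using Smeas[of 1] Smeas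
      by (simp add: nn_integral_suminf A B measurable_compose[OF _ measurable_ennreal])
    also have "\<dots> = ennreal (K * ?r * (1 / (1 - q1)) + K * ?r * (1 / (1 - q2)))"
      unfolding geo[OF q1] geo[OF q2] using K q1 q2 by (simp flip: ennreal_plus)
    also have "\<dots> = ennreal (C * ?r)"
      by (simp add: C_def algebra_simps)
    finally show ?thesis .
  qed
  show thesis
  proof (rule that[OF C])
    fix R :: real assume R: "0 < R"
    show "integrable lebesgue (\<lambda>y::'a. min 1 ((norm y / R)\<^sup>2) / norm y powr p)"
      using bound[OF R] by (intro integrableI_nonneg meas) (auto intro: le_less_trans)
    show "(LINT y::'a|lebesgue. min 1 ((norm y / R)\<^sup>2) / norm y powr p) \<le> C * R powr (- 2 * s)"
      using bound[OF R] C
      by (subst integral_eq_nn_integral[OF meas]) (auto intro: enn2real_leI)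
  qed
qed

end

section \<open>Pointwise bounds and the perturbed maximum\<close>

text \<open>By continuity the set where an essential bound fails is open. It is also negligible,
  hence empty.\<close>

lemma Linfty_on_continuous_bounded:
  fixes v :: "'a::euclidean_space \<Rightarrow> real"
  assumes "open D" "continuous_on D v" "Linfty_on D v"
  obtains C where "\<And>x. x \<in> D \<Longrightarrow> \<bar>v x\<bar> \<le> C"
proof -
  obtain C where C: "AE x in lebesgue_on D. \<bar>v x\<bar> \<le> C"
    using assms by (auto simp: Linfty_on_def)
  have "AE x in lebesgue. x \<in> D \<longrightarrow> \<bar>v x\<bar> \<le> C"
    using C assms(1) by (subst (asm) AE_restrict_space_iff) auto
  then obtain N where "{x. \<not> (x \<in> D \<longrightarrow> \<bar>v x\<bar> \<le> C)} \<subseteq> N" "N \<in> null_sets lebesgue"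
    by (rule AE_E) (auto simp: null_sets_def)
  then have neg: "negligible {x. \<not> (x \<in> D \<longrightarrow> \<bar>v x\<bar> \<le> C)}"
    by (metis negligible_iff_null_sets negligible_subset)
  have "open (D \<inter> (\<lambda>x. \<bar>v x\<bar>) -` {C<..})"
    using assms by (intro continuous_open_preimage continuous_intros) auto
  moreover have "D \<inter> (\<lambda>x. \<bar>v x\<bar>) -` {C<..} = {x. \<not> (x \<in> D \<longrightarrow> \<bar>v x\<bar> \<le> C)}"
    by auto
  ultimately have "{x. \<not> (x \<in> D \<longrightarrow> \<bar>v x\<bar> \<le> C)} = {}"
    using neg open_not_negligible by metis
  then show thesis
    by (intro that[of C]) auto
qed

definition cap :: "'a::real_inner \<Rightarrow> real \<Rightarrow> 'a \<Rightarrow> real" where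
  "cap x0 R x = max 0 (1 - (norm (x - x0) / R)\<^sup>2)"

lemma cap_bounds: "0 \<le> cap x0 R x" "cap x0 R x \<le> 1"
  by (auto simp: cap_def)

text \<open>The cap lies above its paraboloid everywhere and agrees with it where the cap is
  positive. Its second difference is therefore at most that of the paraboloid, which the
  parallelogram law evaluates to \<open>2 * (norm y / R)^2\<close>. The alternative bound 2 follows
  from the values of the cap lying between 0 and 1.\<close>

lemma cap_second_difference:
  assumes "0 < cap x0 R x"
  shows "2 * cap x0 R x - cap x0 R (x + y) - cap x0 R (x - y) \<le> 2 * min 1 ((norm y / R)\<^sup>2)"
proof -
  have eq: "(norm (x + y - x0))\<^sup>2 + (norm (x - y - x0))\<^sup>2 = 2 * (norm (x - x0))\<^sup>2 + 2 * (norm y)\<^sup>2"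
    by (simp add: power2_norm_eq_inner inner_simps inner_commute)
  have "2 * cap x0 R x - cap x0 R (x + y) - cap x0 R (x - y)
    \<le> 2 * (1 - (norm (x - x0) / R)\<^sup>2) - (1 - (norm (x + y - x0) / R)\<^sup>2) - (1 - (norm (x - y - x0) / R)\<^sup>2)"
    using assms by (auto simp: cap_def)
  also have "\<dots> = ((norm (x + y - x0))\<^sup>2 + (norm (x - y - x0))\<^sup>2 - 2 * (norm (x - x0))\<^sup>2) / R\<^sup>2"
    by (simp add: power_divide diff_divide_distrib add_divide_distrib)
  also have "\<dots> = 2 * (norm y / R)\<^sup>2"
    by (simp add: eq power_divide)
  finally show ?thesis
    using cap_bounds[of x0 R x] cap_bounds[of x0 R "x + y"] cap_bounds[of x0 R "x - y"]
    by (simp add: min_def)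
qed

text \<open>On the compact set \<open>?K\<close> a maximum exists, and it exceeds \<open>M\<close>
  because the cap adds \<open>d\<close> at \<open>x0\<close>. Outside \<open>D\<close> the sum is at
  most \<open>d < M\<close>; in \<open>D\<close> beyond distance \<open>R\<close> the cap vanishes
  and the sum is at most \<open>M\<close>. Hence the maximum over \<open>?K\<close> is global, even
  for unbounded \<open>D\<close>, and is attained in \<open>D\<close> rather than on its
  boundary.\<close>

lemma perturbed_maximum:
  fixes v :: "'a::euclidean_space \<Rightarrow> real"
  assumes "continuous_on (closure D) v" "\<And>x. x \<notin> D \<Longrightarrow> v x \<le> 0" "\<And>x. x \<in> D \<Longrightarrow> v x \<le> M"
    and "0 < d" "d < M" "0 < R" "x0 \<in> D" "M - d < v x0"
  obtains x1 where "x1 \<in> D" "norm (x1 - x0) \<le> R" "0 < cap x0 R x1" "M < v x1 + d * cap x0 R x1"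
    "\<And>z. v z + d * cap x0 R z \<le> v x1 + d * cap x0 R x1"
proof -
  let ?w = "\<lambda>x. v x + d * cap x0 R x"
  let ?K = "closure D \<inter> cball x0 R"
  have x0: "x0 \<in> ?K"
    using assms closure_subset by fastforce
  have "compact ?K"
    by (simp add: closed_Int_compact)
  moreover have "continuous_on ?K ?w"
    unfolding cap_def using assms(1,6)
    by (intro continuous_intros) (auto intro: continuous_on_subset)
  ultimately obtain x1 where x1: "x1 \<in> ?K" "\<And>z. z \<in> ?K \<Longrightarrow> ?w z \<le> ?w x1"
    using continuous_attains_sup[of ?K ?w] x0 by blast
  have "cap x0 R x0 = 1"
    by (simp add: cap_def)
  then have big: "M < ?w x1"
    using x1(2)[OF x0] assms by simp
  have out: "?w z < M" if "z \<notin> D" for z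
    using assms(2)[OF that] mult_left_le[OF cap_bounds(2)[of x0 R z], of d] assms(4,5) by linarith
  have far: "?w z \<le> M" if "z \<in> D" "R < norm (z - x0)" for z
  proof -
    have "1 \<le> norm (z - x0) / R"
      using that assms by simp
    then have "cap x0 R z = 0"
      by (simp add: cap_def one_le_power)
    then show ?thesis
      using assms(3)[OF that(1)] by simp
  qed
  have "x1 \<in> D"
    using out[of x1] big by fastforce
  moreover have "?w z \<le> ?w x1" for z
  proof (cases "z \<in> ?K")
    case False
    then consider "z \<notin> D" | "z \<in> D" "R < norm (z - x0)"
      using closure_subset by (fastforce simp: dist_norm norm_minus_commute)
    then show ?thesis
      using out[of z] far[of z] big by cases auto
  qed (rule x1)
  moreover have "0 < cap x0 R x1"
    using big assms(3)[OF \<open>x1 \<in> D\<close>] assms(4) zero_less_mult_pos[of d "cap x0 R x1"] by simp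
  moreover have "norm (x1 - x0) \<le> R"
    using x1(1) by (simp add: dist_norm norm_minus_commute)
  ultimately show thesis
    using big by (intro that) auto
qed

section \<open>The maximum principle, by contradiction at the perturbed maximum\<close>

theorem theorem2p4:
  fixes s c :: real
    and D :: "(real^'n) set"
    and k :: 'n
    and v :: "real^'n \<Rightarrow> real"
  assumes "0 < s" and "s < 1"
    and "0 < c"
    and "open D" and "D \<subseteq> {x. x $ k > 0}"
    and "Linfty_on D v" and "C2_on D v"
    and "continuous_on (closure D) v"
    and "\<forall>x\<in>D. frac_lap_exists s v x \<and> frac_lap c s v x \<le> 0"
    and "\<forall>x\<in>-D. v x \<le> 0"
  shows "\<forall>x\<in>D. v x \<le> 0"
proof (rule ccontr)
  assume "\<not> (\<forall>x\<in>D. v x \<le> 0)"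
  then obtain z where z: "z \<in> D" "0 < v z"
    by auto
  obtain B where B: "\<And>x. x \<in> D \<Longrightarrow> \<bar>v x\<bar> \<le> B"
    using Linfty_on_continuous_bounded[of D v] assms
      continuous_on_subset[OF assms(8) closure_subset] by blast
  define M where "M = (SUP x\<in>D. v x)"
  have bdd: "bdd_above (v ` D)"
    using B by (intro bdd_aboveI2[of _ _ B]) (simp add: abs_le_iff)
  have le_M: "v x \<le> M" if "x \<in> D" for x
    unfolding M_def using that bdd by (rule cSUP_upper)
  have M: "0 < M"
    using z le_M[of z] by simp

  define p where "p = real CARD('n) + 2 * s"
  have p: "0 < p"
    using assms(1) by (simp add: p_def add_nonneg_pos)
  define g where "g = (\<lambda>R (y::real^'n). min 1 ((norm y / R)\<^sup>2) / norm y powr p)"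
  obtain C where C: "0 \<le> C" and g_int: "\<And>R. 0 < R \<Longrightarrow> integrable lebesgue (g R)"
    and g_le: "\<And>R. 0 < R \<Longrightarrow> integral\<^sup>L lebesgue (g R) \<le> C * R powr (- 2 * s)"
    using truncated_kernel_integral_bound[where 'a = "real^'n", OF assms(1,2)]
    unfolding g_def p_def by (auto simp: DIM_cart)

  \<comment> \<open>\<open>a * R powr (- 2 * s)\<close> will be the volume of a ball of radius
    \<open>R\<close> times the kernel at distance \<open>4 * R\<close>.\<close>
  define a where "a = 4 powr (-p) * unit_ball_vol (real CARD('n))"
  have a: "0 < a"
    by (simp add: a_def)
  \<comment> \<open>The two bounds give
    \<open>2 * d * C + 2 * d \<le> M * a / 2 \<le> (M - d) * a\<close>. The summand 4 in the
    denominator makes the comparison strict and keeps the denominator positive when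
    \<open>C = 0\<close>.\<close>
  define d where "d = min (M / 2) (M * a / (4 * C + 4))"
  have d: "0 < d" "d \<le> M / 2"
    using M a C unfolding d_def by (simp, intro min.cobounded1)
  have "d \<le> M * a / (4 * C + 4)"
    by (simp add: d_def)
  then have "d * (4 * C + 4) \<le> M * a"
    using C by (simp add: pos_le_divide_eq)
  then have dC: "2 * d * C < (M - d) * a"
    using d mult_right_mono[of "M/2" "M - d" a] a by (simp add: algebra_simps)

  obtain x0 where x0: "x0 \<in> D" "M - d < v x0"
    using less_cSUP_iff[OF _ bdd, of "M - d"] z d unfolding M_def by auto
  define R where "R = x0 $ k"
  have R: "0 < R"
    using x0 assms(5) by (auto simp: R_def)
  obtain x1 where x1: "x1 \<in> D" "norm (x1 - x0) \<le> R" "0 < cap x0 R x1"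
      "M < v x1 + d * cap x0 R x1"
    and x1_max: "\<And>z. v z + d * cap x0 R z \<le> v x1 + d * cap x0 R x1"
    using perturbed_maximum[OF assms(8) _ le_M d(1) _ R x0] assms(10) d M by auto
  have height: "x1 $ k \<le> 2 * R"
    using component_le_norm_cart[of "x1 - x0" k] x1(2) by (simp add: R_def)

  \<comment> \<open>For \<open>y\<close> in \<open>E\<close> the point \<open>x1 - y\<close> has
    height at most 0, since \<open>x1\<close> has height at most \<open>2 * R\<close>; so it lies
    outside \<open>D\<close>. As \<open>norm y \<le> 4 * R\<close>, the kernel is at least
    \<open>(4 * R) powr (-p)\<close> on \<open>E\<close>.\<close>
  define E where "E = ball (axis k (3 * R)) R"
  have E: "2 * R \<le> y $ k" "norm y \<le> 4 * R" if "y \<in> E" for y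
  proof -
    have n: "norm (y - axis k (3 * R)) < R"
      using that by (simp add: E_def dist_norm norm_minus_commute)
    show "2 * R \<le> y $ k"
      using component_le_norm_cart[of "y - axis k (3 * R)" k] n by simp
    have "norm (axis k (3 * R) :: real^'n) = 3 * R"
      using R by (simp add: norm_eq_sqrt_inner inner_axis_axis real_sqrt_mult)
    then show "norm y \<le> 4 * R"
      using norm_triangle_ineq2[of y "axis k (3 * R)"] n by simp
  qed
  have lower: "(M - d) * ((4 * R) powr (-p) * indicator E y) - 2 * d * g R y
    \<le> frac_lap_integrand s v x1 y" for y
  proof (cases "y = 0")
    \<comment> \<open>Both sides are 0: the origin is not in \<open>E\<close>, and the numerators of
      \<open>g\<close> and of the integrand vanish there.\<close>
    case True
    then show ?thesis
      using E(1)[of 0] R by (auto simp: frac_lap_integrand_def g_def indicator_def)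
  next
    case False
    let ?w = "\<lambda>x. v x + d * cap x0 R x"
    let ?N = "norm y powr p"
    have N: "0 < ?N"
      using False by simp
    \<comment> \<open>By maximality \<open>?w x1\<close> is at least each of the two other values.
      On \<open>E\<close> the value at \<open>x1 - y\<close> is at most \<open>d\<close>, from the
      cap alone, while \<open>?w x1\<close> exceeds \<open>M\<close>.\<close>
    have "(M - d) * indicator E y \<le> 2 * ?w x1 - ?w (x1 + y) - ?w (x1 - y)"
    proof (cases "y \<in> E")
      case True
      then have "x1 - y \<notin> D"
        using E(1)[OF True] height assms(5) by auto
      then have "v (x1 - y) \<le> 0"
        using assms(10) by simp
      then have "?w (x1 - y) \<le> d"
        using mult_left_le[OF cap_bounds(2)[of x0 R "x1 - y"], of d] d by linarith
      then show ?thesis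
        using True x1(4) x1_max[of "x1 + y"] by simp
    next
      case False
      then show ?thesis
        using x1_max[of "x1 + y"] x1_max[of "x1 - y"] by simp
    qed
    moreover have "d * (2 * cap x0 R x1 - cap x0 R (x1 + y) - cap x0 R (x1 - y))
        \<le> d * (2 * min 1 ((norm y / R)\<^sup>2))"
      using d cap_second_difference[OF x1(3)] by (intro mult_left_mono) auto
    ultimately have "(M - d) * indicator E y - 2 * d * min 1 ((norm y / R)\<^sup>2)
        \<le> 2 * v x1 - v (x1 + y) - v (x1 - y)"
      by (simp add: algebra_simps)
    then have "((M - d) * indicator E y - 2 * d * min 1 ((norm y / R)\<^sup>2)) / ?N
        \<le> (2 * v x1 - v (x1 + y) - v (x1 - y)) / ?N"
      using N by (intro divide_right_mono) auto
    then have "(M - d) * (indicator E y / ?N) - 2 * d * g R y \<le> frac_lap_integrand s v x1 y"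
      by (simp add: frac_lap_integrand_def g_def p_def diff_divide_distrib)
    moreover have "(4 * R) powr (-p) * indicator E y \<le> indicator E y / ?N"
    proof (cases "y \<in> E")
      case True
      then have "(4 * R) powr (-p) \<le> norm y powr (-p)"
        using E(2)[OF True] p False by (intro powr_mono2') auto
      then show ?thesis
        using True by (simp add: powr_minus divide_simps)
    qed simp
    ultimately show ?thesis
      using mult_left_mono[of "(4 * R) powr (-p) * indicator E y" "indicator E y / ?N" "M - d"] d M
      by linarith
  qed

  have E_int: "integrable lebesgue (indicator E :: _ \<Rightarrow> real)"
    by (auto simp: E_def emeasure_ball R less_imp_le intro: integrable_real_indicator)
  have E_meas: "measure lebesgue E = unit_ball_vol (real CARD('n)) * R powr (real CARD('n))"
    using R content_ball[of R "axis k (3 * R)"] by (simp add: E_def powr_realpow)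
  have "(4 * R) powr (-p) * measure lebesgue E
      = a * (R powr (-p) * R powr (real CARD('n)))"
    using R by (simp add: E_meas a_def powr_mult)
  also have "R powr (-p) * R powr (real CARD('n)) = R powr (- 2 * s)"
    by (simp add: p_def flip: powr_add)
  finally have E_val: "(4 * R) powr (-p) * measure lebesgue E = a * R powr (- 2 * s)" .

  \<comment> \<open>The gain from \<open>E\<close> and the loss from the cap scale by the same power
    of \<open>R\<close>, so the choice of \<open>d\<close> decides the sign whatever
    \<open>R\<close> is.\<close>
  have "0 < ((M - d) * a - 2 * d * C) * R powr (- 2 * s)"
    using dC R by simp
  also have "\<dots> = (M - d) * (a * R powr (- 2 * s)) - 2 * d * (C * R powr (- 2 * s))"
    by (simp add: algebra_simps)
  also have "\<dots> \<le> (M - d) * ((4 * R) powr (-p) * measure lebesgue E)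
      - 2 * d * integral\<^sup>L lebesgue (g R)"
    unfolding E_val using g_le[OF R] d by (intro diff_left_mono mult_left_mono) auto
  also have "\<dots> = (LINT y|lebesgue. (M - d) * ((4 * R) powr (-p) * indicator E y) - 2 * d * g R y)"
    using E_int g_int[OF R] by (subst Bochner_Integration.integral_diff) auto
  \<comment> \<open>Monotonicity requires integrability on both sides; for the right-hand side it is
    \<open>frac_lap_exists\<close> at \<open>x1\<close>.\<close>
  also have "\<dots> \<le> (LINT y|lebesgue. frac_lap_integrand s v x1 y)"
    using E_int g_int[OF R] assms(9) x1(1) lower
    by (intro integral_mono) (auto simp: frac_lap_exists_def)
  also have "\<dots> \<le> 0"
    using assms(3,9) x1(1) by (auto simp: frac_lap_def mult_le_0_iff)
  finally show False
    by simp
qed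

end
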